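(* Let $A,B,C$ be random variables with values in metric spaces $\mathcal{A},\mathcal{B},\mathcal{C}$. Assume that their joint distribution is absolutely continuous with respect to a product measure, with density $p(\cdot)$, and that the density $(a,b,c)\mapsto p(a,b,c)$ is continuous. Assume that there are two different sets $U^{c^*}_1\neq U^{c^*}_2$ (two different equivalence classes of path-connected components of $\mathrm{supp}_{c^*}(A,B)$, see context) for some $c^*$ with $p(c^* )>0$. Then there is a random variable $X$ such that the intersection property $$X \perp\!\!\!\perp A \mid (B,C)\ \text{ and }\ X \perp\!\!\!\perp B\mid (A,C)\quad\Longrightarrow\quad X\perp\!\!\!\perp (A,B)\mid C$$ does not hold for the joint distribution of $X,A,B,C$.
   Context: The random variables may be multi-dimensional. It is assumed throughout that joint distributions (including that of $X,A,B,C$) are absolutely continuous with respect to a product measure; $p$ denotes the joint density (e.g. a probability mass function or probability density function), and also its marginal and conditional densities, distinguished by their arguments. Conditional independence: $X \perp\!\!\!\perp A \mid B$ means $p(x,a\mid b)=p(x\mid b)\,p(a\mid b)$ for all $x,a,b$ with $p(b)>0$. A path in a metric space $\mathcal{S}$ is a continuous map $\lambda:[0,1]\to\mathcal{S}$; a set is path-connected if any two of its points are joined by a path inside it. For $c$ with $p(c)>0$ define the (not necessarily closed) support $\mathrm{supp}_c(A,B):=\{(a,b): p(a,b,c)>0\}$. For $M\subset\mathcal{A}\times\mathcal{B}$ let $\mathrm{proj}_A(M):=\{a\in\mathcal{A}:\exists b \text{ with }(a,b)\in M\}$ and $\mathrm{proj}_B(M):=\{b\in\mathcal{B}:\exists a\text{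 with }(a,b)\in M\}$. Let $(Z^c_i)_i$ be the path-connected components of $\mathrm{supp}_c(A,B)$. Two components $Z^c_{i_1},Z^c_{i_2}$ are coordinate-wise connected if $\mathrm{proj}_A(Z^c_{i_1})\cap\mathrm{proj}_A(Z^c_{i_2})\neq\emptyset$ or $\mathrm{proj}_B(Z^c_{i_1})\cap\mathrm{proj}_B(Z^c_{i_2})\neq\emptyset$. Two components $Z^c_i,Z^c_j$ are equivalent if there is a finite sequence $Z^c_i=Z^c_{i_1},\dots,Z^c_{i_m}=Z^c_j$ in which any two neighbours are coordinate-wise connected. Each equivalence class is represented by the union of its members; these unions are denoted $(U^c_i)_i$. The case without a variable $C$ is treated as $C$ being deterministic, $p(c)=1$ for some $c$. *)

theory Defs
  imports "HOL-Probability.Probability"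
begin

definition supp_at :: "('a \<times> 'b \<times> 'c \<Rightarrow> real) \<Rightarrow> 'c \<Rightarrow> ('a \<times> 'b) set" where
  "supp_at p c = {(a, b). p (a, b, c) > 0}"

definition path_comps :: "'a::topological_space set \<Rightarrow> 'a set set" where
  "path_comps S = path_component_set S ` S"

definition coord_connected :: "('a \<times> 'b) set \<Rightarrow> ('a \<times> 'b) set \<Rightarrow> bool" where
  "coord_connected Z W \<longleftrightarrow> fst ` Z \<inter> fst ` W \<noteq> {} \<or> snd ` Z \<inter> snd ` W \<noteq> {}"

definition comp_equiv ::
  "('a::topological_space \<times> 'b::topological_space) set
    \<Rightarrow> (('a \<times> 'b) set \<times> ('a \<times> 'b) set) set" where
  "comp_equiv S = {(Z, W). Z \<in> path_comps S \<and> W \<in> path_comps S \<and> coord_connected Z W}\<^sup>*"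

definition class_unions ::
  "('a::topological_space \<times> 'b::topological_space) set \<Rightarrow> ('a \<times> 'b) set set" where
  "class_unions S = Union ` (path_comps S // comp_equiv S)"

(* Conditional independence of X and Y given Z, for a joint density f taken with respect to
   a product measure with factors MX and MY for X and Y.  It is a pointwise condition on f:
   f(x,y|z) = f(x|z) f(y|z) wherever f(z) > 0.  The marginals are nonnegative integrals,
   which may diverge for some z; a conditional density given z exists only if f(z) is finite,
   and only such z are considered.  The reference measure of Z does not enter. *)
definition cond_indep_density ::
  "'x measure \<Rightarrow> 'y measure \<Rightarrow> ('x \<Rightarrow> 'y \<Rightarrow> 'z \<Rightarrow> ennreal) \<Rightarrow> bool" where
  "cond_indep_density MX MY f \<longleftrightarrow>
     (\<forall>x \<in> space MX. \<forall>y \<in> space MY. \<forall>z.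
        let fz = (\<integral>\<^sup>+ (x', y'). f x' y' z \<partial>(MX \<Otimes>\<^sub>M MY));
            fxz = (\<integral>\<^sup>+ y'. f x y' z \<partial>MY);
            fyz = (\<integral>\<^sup>+ x'. f x' y z \<partial>MX)
        in 0 < fz \<and> fz < \<infinity> \<longrightarrow> f x y z / fz = (fxz / fz) * (fyz / fz))"

definition intersection_property ::
  "'x measure \<Rightarrow> 'a measure \<Rightarrow> 'b measure \<Rightarrow> ('x \<times> 'a \<times> 'b \<times> 'c \<Rightarrow> ennreal) \<Rightarrow> bool" where
  "intersection_property MX MA MB q \<longleftrightarrow>
     (cond_indep_density MX MA (\<lambda>x a (b, c). q (x, a, b, c)) \<and>
      cond_indep_density MX MB (\<lambda>x b (a, c). q (x, a, b, c)) \<longrightarrow>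
      cond_indep_density MX (MA \<Otimes>\<^sub>M MB) (\<lambda>x (a, b) c. q (x, a, b, c)))"

end

theory Submission imports Defs begin

text \<open>
  Points of the support that share a coordinate lie in the same class. Since the support is open,
  it contains a box around each of its points, and moving inside a box one coordinate at a time
  shows that each class $U$ is open, although path components need not be. On the support,
  $(a,b) \in U$ is equivalent to $a \in \mathrm{proj}_A(U)$ and also to $b \in \mathrm{proj}_B(U)$.
  Let $X$ be the indicator of $C = c^* \wedge A \in \mathrm{proj}_A(U)$. It is a function of
  $(A,C)$ and, where the density is positive, also of $(B,C)$, which gives both premises of the
  intersection property. Given $C = c^*$ it is a function of $(A,B)$ that takes different values
  at two points of positive density, hence it is not independent of $(A,B)$.
\<close>

section \<open>Path components of a set and the unions of their equivalence classes\<close>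

lemma path_comps_overlap:
  assumes "Z \<in> path_comps S" "W \<in> path_comps S" "t \<in> Z" "t \<in> W"
  shows "Z = W"
  using assms unfolding path_comps_def
  by (metis (no_types, lifting) imageE mem_Collect_eq path_component_eq)

lemma path_comps_subset: "Z \<in> path_comps S \<Longrightarrow> Z \<subseteq> S"
  unfolding path_comps_def using path_component_subset by fastforce

lemma path_comps_cover: "t \<in> S \<Longrightarrow> \<exists>Z \<in> path_comps S. t \<in> Z"
  unfolding path_comps_def by (auto intro!: bexI[of _ t] path_component_refl)

text \<open>Every proper step of the relation ends in a path component. The reflexive closure,
  however, relates every set to itself, including sets that are not path components; hence the
  assumption on \<open>Z\<close>.\<close>

lemma comp_equiv_in_path_comps:
  assumes "(Z, W) \<in> comp_equiv S" "Z \<in> path_comps S"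
  shows "W \<in> path_comps S"
  using assms unfolding comp_equiv_def by (induction rule: rtrancl_induct) auto

lemma sym_comp_equiv: "sym (comp_equiv S)"
  unfolding comp_equiv_def
  by (intro sym_rtrancl symI) (auto simp: coord_connected_def)

lemma trans_comp_equiv: "trans (comp_equiv S)"
  unfolding comp_equiv_def by (rule trans_rtrancl)

lemma class_unions_subset: "U \<in> class_unions S \<Longrightarrow> U \<subseteq> S"
  unfolding class_unions_def quotient_def
  using comp_equiv_in_path_comps path_comps_subset by fastforce

lemma class_unions_nonempty:
  assumes "U \<in> class_unions S"
  shows "U \<noteq> {}"
proof -
  obtain Z where Z: "Z \<in> path_comps S" "U = \<Union> (comp_equiv S `` {Z})"
    using assms unfolding class_unions_def quotient_def by auto
  moreover have "(Z, Z) \<in> comp_equiv S"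
    unfolding comp_equiv_def by simp
  moreover have "Z \<noteq> {}"
  proof -
    obtain t where "t \<in> S" "Z = path_component_set S t"
      using Z(1) unfolding path_comps_def by blast
    then have "t \<in> Z" by (simp add: path_component_refl)
    then show ?thesis by blast
  qed
  ultimately show ?thesis by blast
qed

text \<open>A common point lies in just one path component. This component is related to the
  representatives of both classes, so symmetry and transitivity identify the classes.\<close>

lemma class_unions_overlap:
  assumes "U \<in> class_unions S" "U' \<in> class_unions S" "t \<in> U" "t \<in> U'"
  shows "U = U'"
proof -
  obtain Z where Z: "Z \<in> path_comps S" "U = \<Union> (comp_equiv S `` {Z})"
    using assms(1) unfolding class_unions_def quotient_def by auto
  obtain Z' where Z': "Z' \<in> path_comps S" "U' = \<Union> (comp_equiv S `` {Z'})"
    using assms(2) unfolding class_unions_def quotient_def by auto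
  obtain W where W: "(Z, W) \<in> comp_equiv S" "t \<in> W" using Z assms(3) by auto
  obtain W' where W': "(Z', W') \<in> comp_equiv S" "t \<in> W'" using Z' assms(4) by auto
  have "W = W'"
    using path_comps_overlap W W' Z(1) Z'(1) comp_equiv_in_path_comps by metis
  then have "(Z, Z') \<in> comp_equiv S" "(Z', Z) \<in> comp_equiv S"
    using W W' sym_comp_equiv[of S] trans_comp_equiv[of S] by (meson symD transD)+
  then have "comp_equiv S `` {Z} = comp_equiv S `` {Z'}"
    using trans_comp_equiv[of S] by (auto dest: transD)
  then show ?thesis using Z Z' by simp
qed

text \<open>The path components of \<open>s\<close> and \<open>t\<close> both project onto the
  shared coordinate, so they are coordinate-wise connected and belong to the same class.\<close>

lemma class_unions_closed:
  assumes "U \<in> class_unions S" "s \<in> U" "t \<in> S" "fst s = fst t \<or> snd s = snd t"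
  shows "t \<in> U"
proof -
  obtain Z where Z: "Z \<in> path_comps S" "U = \<Union> (comp_equiv S `` {Z})"
    using assms(1) unfolding class_unions_def quotient_def by auto
  obtain W where W: "(Z, W) \<in> comp_equiv S" "s \<in> W" using Z assms(2) by auto
  obtain T where T: "T \<in> path_comps S" "t \<in> T" using path_comps_cover assms(3) by blast
  have "coord_connected W T"
    unfolding coord_connected_def using W(2) T(2) assms(4) by (metis disjoint_iff imageI)
  then have "(W, T) \<in> comp_equiv S"
    unfolding comp_equiv_def using T(1) comp_equiv_in_path_comps[OF W(1) Z(1)] by auto
  then have "(Z, T) \<in> comp_equiv S"
    using W(1) trans_comp_equiv[of S] by (meson transD)
  then show ?thesis using Z T by auto
qed

text \<open>Within \<open>S\<close>, either coordinate alone decides membership in \<open>U\<close>.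
  This allows one and the same variable to be read off from the first coordinate or from the
  second.\<close>

lemma class_unions_mem_iff:
  assumes "U \<in> class_unions S" "(a, b) \<in> S"
  shows "a \<in> fst ` U \<longleftrightarrow> (a, b) \<in> U" and "b \<in> snd ` U \<longleftrightarrow> (a, b) \<in> U"
  using class_unions_closed[OF assms(1) _ assms(2)] by force+

text \<open>Openness is what makes the projection of \<open>U\<close> open, hence Borel, so that its
  indicator is measurable.\<close>

lemma open_class_unions:
  assumes "U \<in> class_unions S" "open S"
  shows "open U"
proof (rule topological_space_class.openI)
  fix s assume s: "s \<in> U"
  obtain V W where VW: "open V" "open W" "s \<in> V \<times> W" "V \<times> W \<subseteq> S"
    using open_prod_elim[OF assms(2)] class_unions_subset[OF assms(1)] s by (metis subsetD)
  have "t \<in> U" if t: "t \<in> V \<times> W" for t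
  proof -
    \<comment> \<open>This corner of the box shares its first coordinate with \<open>s\<close> and
      its second with \<open>t\<close>, so two applications of closedness lead from \<open>s\<close>
      to \<open>t\<close>.\<close>
    have "(fst s, snd t) \<in> S" "t \<in> S" using VW t by auto
    then show ?thesis
      using class_unions_closed[OF assms(1) s, of "(fst s, snd t)"]
        class_unions_closed[OF assms(1), of "(fst s, snd t)" t] by simp
  qed
  then show "\<exists>T. open T \<and> s \<in> T \<and> T \<subseteq> U"
    using VW by (intro exI[of _ "V \<times> W"] conjI open_Times subsetI)
qed

lemma open_supp_at:
  fixes p :: "'a::topological_space \<times> 'b::topological_space \<times> 'c::topological_space \<Rightarrow> real"
  assumes "continuous_on UNIV p"
  shows "open (supp_at p c)"
proof -
  have "continuous_on UNIV (\<lambda>ab. p (fst ab, snd ab, c))"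
    by (intro continuous_on_compose2[OF assms] continuous_intros) auto
  then have "open {ab. 0 < p (fst ab, snd ab, c)}"
    by (intro open_Collect_less continuous_intros)
  then show ?thesis by (simp add: supp_at_def case_prod_beta')
qed

section \<open>Densities carried by the graph of a function, and conditional independence for
  them\<close>

lemma nn_integral_indicator_point:
  assumes "{c} \<in> sets M" "emeasure M {c} = 1"
  shows "(\<integral>\<^sup>+ x. k x * indicator {c} x \<partial>M) = k c"
proof -
  have "(\<integral>\<^sup>+ x. k x * indicator {c} x \<partial>M) = (\<integral>\<^sup>+ x. k c * indicator {c} x \<partial>M)"
    by (intro nn_integral_cong) (auto simp: indicator_def)
  then show ?thesis using assms by (simp add: nn_integral_cmult_indicator)
qed

lemma measurable_indicator_graph:
  fixes k :: "'y \<Rightarrow> real"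
  assumes [measurable]: "k \<in> borel_measurable N" and sets: "sets MX = sets borel"
  shows "(\<lambda>(x, y). indicator {k y} x :: ennreal) \<in> borel_measurable (MX \<Otimes>\<^sub>M N)"
proof -
  have [measurable_cong]: "sets MX = sets borel" by fact
  have "(\<lambda>(x, y). if x = k y then 1 else 0 :: ennreal) \<in> borel_measurable (MX \<Otimes>\<^sub>M N)"
    by measurable
  then show ?thesis by (simp add: indicator_def)
qed

text \<open>Tonelli with the integral over \<open>x\<close> inside: the inner integrand lives on the
  single point \<open>k y\<close>, which has mass one.\<close>

lemma nn_integral_graph:
  fixes k :: "'y \<Rightarrow> real"
  assumes "sigma_finite_measure MX" and sets: "sets MX = sets borel"
    and "sigma_finite_measure N"
    and [measurable]: "k \<in> borel_measurable N"
      "(\<lambda>(x, y). h x y) \<in> borel_measurable (MX \<Otimes>\<^sub>M N)"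
    and atom: "\<And>y. y \<in> space N \<Longrightarrow> emeasure MX {k y} = 1"
  shows "(\<integral>\<^sup>+ (x, y). h x y * indicator {k y} x \<partial>(MX \<Otimes>\<^sub>M N)) = (\<integral>\<^sup>+ y. h (k y) y \<partial>N)"
proof -
  interpret pair_sigma_finite MX N using assms by (simp add: pair_sigma_finite_def)
  note [measurable] = measurable_indicator_graph[OF assms(4) sets]
  have "(\<integral>\<^sup>+ (x, y). h x y * indicator {k y} x \<partial>(MX \<Otimes>\<^sub>M N))
      = (\<integral>\<^sup>+ y. \<integral>\<^sup>+ x. h x y * indicator {k y} x \<partial>MX \<partial>N)"
    by (subst nn_integral_snd[symmetric]) (auto simp: case_prod_beta')
  also have "\<dots> = (\<integral>\<^sup>+ y. h (k y) y \<partial>N)"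
    using atom by (intro nn_integral_cong nn_integral_indicator_point) (auto simp: sets)
  finally show ?thesis .
qed

text \<open>The joint law sits on the graph of \<open>g\<close>. It has a density because
  \<open>MX\<close> has an atom at each value of \<open>g\<close>; since these atoms have mass one,
  \<open>f\<close> appears without a correction factor.\<close>

lemma distributed_graph:
  fixes g :: "'y \<Rightarrow> real"
  assumes "sigma_finite_measure MX" and sets: "sets MX = sets borel"
    and "sigma_finite_measure N"
    and Z: "distributed M N Z f"
    and [measurable]: "g \<in> borel_measurable N"
    and atom: "\<And>y. y \<in> space N \<Longrightarrow> emeasure MX {g y} = 1"
  shows "distributed M (MX \<Otimes>\<^sub>M N) (\<lambda>w. (g (Z w), Z w)) (\<lambda>(x, y). f y * indicator {g y} x)"
proof -
  have [measurable_cong]: "sets MX = sets borel" by fact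
  have [measurable]: "f \<in> borel_measurable N" "Z \<in> measurable M N"
    using Z distributed_borel_measurable distributed_measurable by blast+
  note [measurable] = measurable_indicator_graph[OF assms(5) sets]
  have dens: "(\<lambda>(x, y). f y * indicator {g y} x) \<in> borel_measurable (MX \<Otimes>\<^sub>M N)"
    by (simp add: case_prod_beta')
  have "distr M (MX \<Otimes>\<^sub>M N) (\<lambda>w. (g (Z w), Z w))
      = density (MX \<Otimes>\<^sub>M N) (\<lambda>(x, y). f y * indicator {g y} x)"
  proof (rule measure_eqI)
    fix T assume "T \<in> sets (distr M (MX \<Otimes>\<^sub>M N) (\<lambda>w. (g (Z w), Z w)))"
    then have T[measurable]: "T \<in> sets (MX \<Otimes>\<^sub>M N)" by simp
    let ?T = "{y \<in> space N. (g y, y) \<in> T}"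
    have "emeasure (distr M (MX \<Otimes>\<^sub>M N) (\<lambda>w. (g (Z w), Z w))) T
        = emeasure M ((\<lambda>w. (g (Z w), Z w)) -` T \<inter> space M)"
      by (intro emeasure_distr) auto
    \<comment> \<open>Pulling \<open>T\<close> back along the graph map turns the event into one
      about \<open>Z\<close> alone, whose density is known.\<close>
    also have "(\<lambda>w. (g (Z w), Z w)) -` T \<inter> space M = Z -` ?T \<inter> space M"
      using measurable_space[OF \<open>Z \<in> measurable M N\<close>] by auto
    also have "emeasure M \<dots> = (\<integral>\<^sup>+ y. f y * indicator ?T y \<partial>N)"
      by (intro distributed_emeasure[OF Z]) measurable
    also have "\<dots> = (\<integral>\<^sup>+ y. f y * indicator T (g y, y) \<partial>N)"
      by (intro nn_integral_cong) (auto simp: indicator_def)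
    \<comment> \<open>Here the graph formula is read from right to left, to return from
      \<open>N\<close> to the product measure.\<close>
    also have "\<dots> = (\<integral>\<^sup>+ (x, y). (f y * indicator T (x, y)) * indicator {g y} x \<partial>(MX \<Otimes>\<^sub>M N))"
      using assms by (intro nn_integral_graph[symmetric]) (auto simp: case_prod_beta')
    also have "\<dots> = emeasure (density (MX \<Otimes>\<^sub>M N) (\<lambda>(x, y). f y * indicator {g y} x)) T"
      using dens by (subst emeasure_density) (auto intro!: nn_integral_cong simp: ac_simps)
    finally show "emeasure (distr M (MX \<Otimes>\<^sub>M N) (\<lambda>w. (g (Z w), Z w))) T
        = emeasure (density (MX \<Otimes>\<^sub>M N) (\<lambda>(x, y). f y * indicator {g y} x)) T" .
  qed simp
  then show ?thesis
    using dens by (simp add: distributed_def)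
qed

text \<open>Given \<open>z\<close>, the first variable is the constant \<open>k z\<close>, and a
  constant is independent of everything.\<close>

lemma cond_indep_density_function:
  fixes k :: "'z \<Rightarrow> real"
  assumes "sigma_finite_measure MX" and sets: "sets MX = sets borel"
    and "sigma_finite_measure MY"
    and h: "\<And>z. (\<lambda>y. h y z) \<in> borel_measurable MY"
    and atom: "\<And>z. emeasure MX {k z} = 1"
    and f: "\<And>x y z. f x y z = h y z * indicator {k z} x"
  shows "cond_indep_density MX MY f"
  unfolding cond_indep_density_def Let_def
proof (intro ballI allI impI)
  fix x y z
  let ?z = "\<integral>\<^sup>+ (x', y'). f x' y' z \<partial>(MX \<Otimes>\<^sub>M MY)"
  note [measurable] = h
  assume z: "0 < ?z \<and> ?z < \<infinity>"
  have fz: "?z = (\<integral>\<^sup>+ y. h y z \<partial>MY)"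
    unfolding f using assms by (subst nn_integral_graph) (auto simp: case_prod_beta')
  have "(\<integral>\<^sup>+ y'. f x y' z \<partial>MY) = ?z * indicator {k z} x"
    unfolding fz unfolding f by (intro nn_integral_multc) measurable
  moreover have "(\<integral>\<^sup>+ x'. f x' y z \<partial>MX) = h y z"
    unfolding f using atom by (intro nn_integral_indicator_point) (auto simp: sets)
  \<comment> \<open>The cancellation in \<open>ennreal\<close> requires the total mass to be neither
    zero nor infinite, which is the guard in the definition of conditional independence.\<close>
  moreover have "?z / ?z = 1"
    using z by (intro ennreal_divide_self) auto
  ultimately show "f x y z / ?z
      = ((\<integral>\<^sup>+ y'. f x y' z \<partial>MY) / ?z) * ((\<integral>\<^sup>+ x'. f x' y z \<partial>MX) / ?z)"
    by (auto simp: f indicator_def)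
qed

text \<open>Conversely, a function of \<open>y\<close> that is independent of \<open>y\<close>
  cannot separate two points of positive density. The proof tests the factorization at
  \<open>x = g y1\<close>, once with \<open>y1\<close> and once with \<open>y2\<close>.\<close>

lemma cond_indep_density_function_constant:
  fixes g :: "'y \<Rightarrow> real"
  assumes "sigma_finite_measure MX" and sets: "sets MX = sets borel"
    and "sigma_finite_measure MY"
    and h[measurable]: "h \<in> borel_measurable MY" and g[measurable]: "g \<in> borel_measurable MY"
    and atom: "\<And>y. emeasure MX {g y} = 1"
    and f: "\<And>x y. f x y z = h y * indicator {g y} x"
    and fin: "0 < (\<integral>\<^sup>+ y. h y \<partial>MY)" "(\<integral>\<^sup>+ y. h y \<partial>MY) < \<infinity>"
    and indep: "cond_indep_density MX MY f"
    and y1: "y1 \<in> space MY" "0 < h y1" "h y1 < \<infinity>" and y2: "y2 \<in> space MY" "0 < h y2"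
  shows "g y1 = g y2"
proof (rule ccontr)
  assume ne: "g y1 \<noteq> g y2"
  let ?z = "\<integral>\<^sup>+ y. h y \<partial>MY" and ?P = "\<integral>\<^sup>+ y. f (g y1) y z \<partial>MY"
  have fz: "(\<integral>\<^sup>+ (x', y'). f x' y' z \<partial>(MX \<Otimes>\<^sub>M MY)) = ?z"
    unfolding f using assms by (subst nn_integral_graph) (auto simp: case_prod_beta')
  have fy: "(\<integral>\<^sup>+ x'. f x' y z \<partial>MX) = h y" for y
    unfolding f using atom by (intro nn_integral_indicator_point) (auto simp: sets)
  have space: "space MX = UNIV"
    using sets_eq_imp_space_eq[OF sets] by simp
  have eq: "f (g y1) y z / ?z = (?P / ?z) * (h y / ?z)" if "y \<in> space MY" for y
    using indep that fin unfolding cond_indep_density_def Let_def space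
    by (metis UNIV_I fz fy)
  have pos: "h y1 / ?z \<noteq> 0" "h y2 / ?z \<noteq> 0"
    using y1 y2 fin by (auto simp: ennreal_divide_eq_0_iff)
  \<comment> \<open>At \<open>y1\<close> the left side is positive, so the marginal at
    \<open>g y1\<close> cannot vanish. At \<open>y2\<close> the left side is zero if
    \<open>g y2\<close> differs from \<open>g y1\<close>, although both factors on the right are
    nonzero.\<close>
  have "?P / ?z \<noteq> 0"
    using eq[OF y1(1)] pos by (auto simp: f)
  then show False
    using eq[OF y2(1)] ne pos by (simp add: f)
qed

section \<open>Construction of the variable that violates the intersection property\<close>

theorem proposition2:
  fixes M :: "'w measure"
    and MA :: "'a::metric_space measure"
    and MB :: "'b::metric_space measure"
    and MC :: "'c::metric_space measure"
    and A :: "'w \<Rightarrow> 'a" and B :: "'w \<Rightarrow> 'b" and C :: "'w \<Rightarrow> 'c"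
    and p :: "'a \<times> 'b \<times> 'c \<Rightarrow> real"
    and c' :: 'c
    and U1 U2 :: "('a \<times> 'b) set"
  assumes "prob_space M"
    and "sigma_finite_measure MA" and "sets MA = sets borel"
    and "sigma_finite_measure MB" and "sets MB = sets borel"
    and "sigma_finite_measure MC" and "sets MC = sets borel"
    and "\<And>z. 0 \<le> p z"
    and "distributed M (MA \<Otimes>\<^sub>M MB \<Otimes>\<^sub>M MC) (\<lambda>w. (A w, B w, C w)) (\<lambda>z. ennreal (p z))"
    and "continuous_on UNIV p"
    and "0 < (\<integral>\<^sup>+ (a, b). ennreal (p (a, b, c')) \<partial>(MA \<Otimes>\<^sub>M MB))"
    and "(\<integral>\<^sup>+ (a, b). ennreal (p (a, b, c')) \<partial>(MA \<Otimes>\<^sub>M MB)) < \<infinity>"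
    and "U1 \<in> class_unions (supp_at p c')"
    and "U2 \<in> class_unions (supp_at p c')"
    and "U1 \<noteq> U2"
  shows "\<exists>(X :: 'w \<Rightarrow> real) (MX :: real measure) (q :: real \<times> 'a \<times> 'b \<times> 'c \<Rightarrow> real).
           sigma_finite_measure MX \<and> sets MX = sets borel \<and>
           (\<forall>z. 0 \<le> q z) \<and>
           distributed M (MX \<Otimes>\<^sub>M MA \<Otimes>\<^sub>M MB \<Otimes>\<^sub>M MC)
             (\<lambda>w. (X w, A w, B w, C w)) (\<lambda>z. ennreal (q z)) \<and>
           (\<forall>a b c. (\<integral>\<^sup>+ x. ennreal (q (x, a, b, c)) \<partial>MX) = ennreal (p (a, b, c))) \<and>
           \<not> intersection_property MX MA MB (\<lambda>z. ennreal (q z))"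
proof -
  interpret MA: sigma_finite_measure MA by fact
  interpret MB: sigma_finite_measure MB by fact
  interpret MC: sigma_finite_measure MC by fact
  interpret AB: pair_sigma_finite MA MB ..
  interpret BC: pair_sigma_finite MB MC ..
  interpret ABC: pair_sigma_finite MA "MB \<Otimes>\<^sub>M MC" ..
  have [measurable_cong]: "sets MA = sets borel" "sets MB = sets borel" "sets MC = sets borel"
    by fact+
  have spaces: "space MA = UNIV" "space MB = UNIV" "space MC = UNIV"
    using assms(3,5,7)[THEN sets_eq_imp_space_eq] by auto
  note dist = assms(9)
  have [measurable]: "(\<lambda>z. ennreal (p z)) \<in> borel_measurable (MA \<Otimes>\<^sub>M MB \<Otimes>\<^sub>M MC)"
    using dist distributed_borel_measurable by blast

  define S where "S = supp_at p c'"
  have S: "(a, b) \<in> S \<longleftrightarrow> 0 < p (a, b, c')" for a b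
    by (simp add: S_def supp_at_def)
  have U1: "U1 \<in> class_unions S" and U2: "U2 \<in> class_unions S"
    using assms(13,14) by (auto simp: S_def)
  define V where "V = fst ` U1"
  define W where "W = snd ` U1"
  have "open U1"
    using open_class_unions[OF U1] open_supp_at[OF assms(10)] by (simp add: S_def)
  then have "open V"
    unfolding V_def by (rule open_image_fst)
  then have V[measurable]: "V \<in> sets borel" by simp
  \<comment> \<open>Both sides are equivalent to \<open>(a, b) \<in> U1\<close>.\<close>
  have VW: "a \<in> V \<longleftrightarrow> b \<in> W" if "0 < p (a, b, c')" for a b
    using class_unions_mem_iff[OF U1] that by (simp add: S V_def W_def)
  obtain a1 b1 where 1: "(a1, b1) \<in> U1"
    using class_unions_nonempty[OF U1] by auto
  then have p1: "0 < p (a1, b1, c')" "a1 \<in> V"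
    using class_unions_subset[OF U1] by (force simp: S V_def)+
  obtain a2 b2 where 2: "(a2, b2) \<in> U2"
    using class_unions_nonempty[OF U2] by auto
  then have p2: "0 < p (a2, b2, c')"
    using class_unions_subset[OF U2] by (auto simp: S[symmetric])
  moreover have "(a2, b2) \<notin> U1"
    using class_unions_overlap[OF U1 U2 _ 2] assms(15) by auto
  ultimately have a2: "a2 \<notin> V"
    using class_unions_mem_iff(1)[OF U1] by (simp add: S V_def)

  \<comment> \<open>Counting measure on {0, 1}, transported to the reals: both possible values of an
    indicator become atoms of mass one.\<close>
  define MX :: "real measure" where "MX = distr (count_space (UNIV :: bool set)) borel of_bool"
  have sets_MX: "sets MX = sets borel" by (simp add: MX_def)
  have atom: "emeasure MX {of_bool P} = 1" for P
  proof -
    have "(of_bool :: bool \<Rightarrow> real) -` {of_bool P} = {P}" by auto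
    then show ?thesis by (simp add: MX_def emeasure_distr)
  qed
  have "finite_measure MX"
    unfolding MX_def
    by (intro finite_measure.finite_measure_distr finite_measure_count_space) auto
  then have sf_MX: "sigma_finite_measure MX" by (simp add: finite_measure_def)

  define g :: "'a \<times> 'b \<times> 'c \<Rightarrow> real" where "g = (\<lambda>(a, b, c). of_bool (a \<in> V \<and> c = c'))"
  define q :: "real \<times> 'a \<times> 'b \<times> 'c \<Rightarrow> real" where "q = (\<lambda>(x, z). p z * indicator {g z} x)"
  have g_meas[measurable]: "g \<in> borel_measurable (MA \<Otimes>\<^sub>M MB \<Otimes>\<^sub>M MC)"
  proof -
    have [measurable]: "{c'} \<in> sets borel" by simp
    \<comment> \<open>As a product of indicators of Borel sets, \<open>g\<close> is visibly
      measurable.\<close>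
    have "g = (\<lambda>(a, b, c). indicator V a * indicator {c'} c)"
      by (auto simp: g_def indicator_def fun_eq_iff)
    then show ?thesis by (simp add: case_prod_beta')
  qed
  have atom_g: "emeasure MX {g z} = 1" for z
    by (cases z) (simp add: g_def atom)
  have q: "ennreal (q (x, z)) = ennreal (p z) * indicator {g z} x" for x z
    by (simp add: q_def indicator_def)

  have "distributed M (MX \<Otimes>\<^sub>M MA \<Otimes>\<^sub>M MB \<Otimes>\<^sub>M MC)
      (\<lambda>w. (g (A w, B w, C w), A w, B w, C w)) (\<lambda>(x, z). ennreal (p z) * indicator {g z} x)"
    using distributed_graph[OF sf_MX sets_MX _ dist g_meas atom_g]
      ABC.sigma_finite_measure_axioms by blast
  moreover have "(\<lambda>(x, z). ennreal (p z) * indicator {g z} x) = (\<lambda>z. ennreal (q z))"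
    by (auto simp: q fun_eq_iff)
  ultimately have dist_q: "distributed M (MX \<Otimes>\<^sub>M MA \<Otimes>\<^sub>M MB \<Otimes>\<^sub>M MC)
      (\<lambda>w. (g (A w, B w, C w), A w, B w, C w)) (\<lambda>z. ennreal (q z))"
    by (simp only:)

  have marginal: "(\<integral>\<^sup>+ x. ennreal (q (x, a, b, c)) \<partial>MX) = ennreal (p (a, b, c))" for a b c
    unfolding q using atom_g by (intro nn_integral_indicator_point) (auto simp: sets_MX)

  have indep_A: "cond_indep_density MX MA (\<lambda>x a (b, c). ennreal (q (x, a, b, c)))"
  proof (rule cond_indep_density_function[OF sf_MX sets_MX MA.sigma_finite_measure_axioms])
    fix x a and bc :: "'b \<times> 'c"
    obtain b c where bc: "bc = (b, c)" by force
    \<comment> \<open>Conditioning on \<open>(b, c)\<close> calls for an expression without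
      \<open>a\<close>, so \<open>V\<close> is traded for \<open>W\<close>. For
      \<open>c = c'\<close> this is \<open>VW\<close>, for other \<open>c\<close> both sides are
      zero, and where \<open>p\<close> vanishes so do both densities.\<close>
    have "g (a, b, c) = of_bool (b \<in> W \<and> c = c')" if "p (a, b, c) \<noteq> 0"
      using VW[of a b] that assms(8)[of "(a, b, c)"] by (auto simp: g_def)
    then show "(case bc of (b, c) \<Rightarrow> ennreal (q (x, a, b, c)))
        = (case bc of (b, c) \<Rightarrow> ennreal (p (a, b, c)))
          * indicator {of_bool (fst bc \<in> W \<and> snd bc = c')} x"
      by (cases "p (a, b, c) = 0") (auto simp: bc q)
  qed (auto simp: atom spaces split: prod.split)

  have indep_B: "cond_indep_density MX MB (\<lambda>x b (a, c). ennreal (q (x, a, b, c)))"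
  proof (rule cond_indep_density_function[OF sf_MX sets_MX MB.sigma_finite_measure_axioms])
    fix x b and ac :: "'a \<times> 'c"
    \<comment> \<open>\<open>g\<close> ignores \<open>b\<close> by definition, so it is already a
      function of \<open>(a, c)\<close>.\<close>
    show "(case ac of (a, c) \<Rightarrow> ennreal (q (x, a, b, c)))
        = (case ac of (a, c) \<Rightarrow> ennreal (p (a, b, c)))
          * indicator {of_bool (fst ac \<in> V \<and> snd ac = c')} x"
      by (auto simp: q g_def split: prod.split)
  qed (auto simp: atom spaces split: prod.split)

  have not_indep: "\<not> cond_indep_density MX (MA \<Otimes>\<^sub>M MB) (\<lambda>x (a, b) c. ennreal (q (x, a, b, c)))"
  proof
    assume indep: "cond_indep_density MX (MA \<Otimes>\<^sub>M MB) (\<lambda>x (a, b) c. ennreal (q (x, a, b, c)))"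
    let ?h = "\<lambda>(a, b). ennreal (p (a, b, c'))" and ?g = "\<lambda>(a, b). g (a, b, c')"
    have [simp]: "c' \<in> space MC" by (simp add: spaces)
    have h: "?h \<in> borel_measurable (MA \<Otimes>\<^sub>M MB)" and g': "?g \<in> borel_measurable (MA \<Otimes>\<^sub>M MB)"
      by measurable
    \<comment> \<open>The total mass at \<open>c'\<close> is positive and finite, so independence
      would force equal values, whereas \<open>g\<close> is 1 at the first point and 0 at the
      second.\<close>
    have "?g (a1, b1) = ?g (a2, b2)"
      using assms(11,12) p1 p2
      by (intro cond_indep_density_function_constant[OF sf_MX sets_MX
              AB.sigma_finite_measure_axioms h g' _ _ _ _ indep, where z = c'])
        (auto simp: atom_g q spaces space_pair_measure)
    then show False using p1 a2 by (simp add: g_def)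
  qed

  show ?thesis
  proof (intro exI conjI allI)
    show "0 \<le> q z" for z
      using assms(8) by (auto simp: q_def split: prod.split)
    show "\<not> intersection_property MX MA MB (\<lambda>z. ennreal (q z))"
      unfolding intersection_property_def using indep_A indep_B not_indep by blast
  qed (fact sf_MX sets_MX dist_q marginal)+
qed

end
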